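(* Let $G$ be a graph and $\overline G$ its complement. Then $q(G)\le 2\chi(\overline G)$.
   Context: For a graph $G$ on $\{1,\dots,n\}$, $\mathcal{S}(G)$ is the set of real symmetric $n\times n$ matrices $A=(a_{ij})$ with $a_{ij}\ne0$ iff $ij\in E(G)$ for $i\ne j$. $q(A)$ is the number of distinct eigenvalues of $A$ and $q(G)=\min\{q(A):A\in\mathcal{S}(G)\}$. $\overline G$ is the complement of $G$, and $\chi$ denotes the chromatic number. *)

theory Defs
  imports "HOL-Analysis.Analysis"
begin

(* A graph on {1..n} is given by its adjacency relation on a finite type 'n with CARD('n) = n. *)
definition simple_graph :: "('n \<Rightarrow> 'n \<Rightarrow> bool) \<Rightarrow> bool" where
  "simple_graph G \<longleftrightarrow> symp G \<and> irreflp G"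

definition complement_graph :: "('n \<Rightarrow> 'n \<Rightarrow> bool) \<Rightarrow> 'n \<Rightarrow> 'n \<Rightarrow> bool" where
  "complement_graph G = (\<lambda>i j. i \<noteq> j \<and> \<not> G i j)"

definition proper_colouring :: "('n \<Rightarrow> 'n \<Rightarrow> bool) \<Rightarrow> nat \<Rightarrow> ('n \<Rightarrow> nat) \<Rightarrow> bool" where
  "proper_colouring G k c \<longleftrightarrow> (\<forall>v. c v < k) \<and> (\<forall>u v. G u v \<longrightarrow> c u \<noteq> c v)"

definition chromatic_number :: "('n \<Rightarrow> 'n \<Rightarrow> bool) \<Rightarrow> nat" where
  "chromatic_number G = (LEAST k. \<exists>c. proper_colouring G k c)"

definition sym_matrices :: "('n::finite \<Rightarrow> 'n \<Rightarrow> bool) \<Rightarrow> (real^'n^'n) set" where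
  "sym_matrices G =
     {A. transpose A = A \<and> (\<forall>i j. i \<noteq> j \<longrightarrow> (A $ i $ j \<noteq> 0 \<longleftrightarrow> G i j))}"

(* Only real eigenvalues are counted; a real symmetric matrix has no others. *)
definition eigenvalues :: "real^'n^'n \<Rightarrow> real set" where
  "eigenvalues A = {l. \<exists>v. v \<noteq> 0 \<and> A *v v = l *s v}"

definition q_matrix :: "real^'n^'n \<Rightarrow> nat" where
  "q_matrix A = card (eigenvalues A)"

(* The infimum is over a nonempty set of naturals, hence a minimum: see q_graph_attained. *)
definition q_graph :: "('n::finite \<Rightarrow> 'n \<Rightarrow> bool) \<Rightarrow> nat" where
  "q_graph G = (INF A \<in> sym_matrices G. q_matrix A)"

lemma sym_matrices_nonempty:
  assumes "simple_graph G"
  shows "sym_matrices G \<noteq> {}"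
proof -
  have "(\<chi> i j. if G i j then 1 else 0) \<in> sym_matrices G"
    using assms unfolding sym_matrices_def simple_graph_def
    by (auto simp: transpose_def vec_eq_iff dest: sympD)
  then show ?thesis by blast
qed

lemma q_graph_attained:
  assumes "simple_graph G"
  shows "\<exists>A \<in> sym_matrices G. q_graph G = q_matrix A"
  using Inf_nat_def1[of "q_matrix ` sym_matrices G"] sym_matrices_nonempty[OF assms]
  unfolding q_graph_def by auto

lemma q_graph_le:
  assumes "A \<in> sym_matrices G"
  shows "q_graph G \<le> q_matrix A"
  unfolding q_graph_def by (rule cINF_lower) (use assms in auto)

(* Hence q_matrix is not an artefact of card being 0 on infinite sets. *)
lemma finite_eigenvalues:
  fixes A :: "real^'n^'n"
  assumes "transpose A = A"
  shows "finite (eigenvalues A)"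
proof -
  obtain f where f: "\<And>l. l \<in> eigenvalues A \<Longrightarrow> f l \<noteq> 0 \<and> A *v f l = l *s f l"
    unfolding eigenvalues_def by atomize_elim (rule choice, auto)
  have orth: "f l \<bullet> f m = 0" if "l \<in> eigenvalues A" "m \<in> eigenvalues A" "l \<noteq> m" for l m
  proof -
    have "(A *v f l) \<bullet> f m = f l \<bullet> (A *v f m)"
      using dot_lmul_matrix[of "f l" A "f m"] assms by (metis transpose_matrix_vector)
    then have "l * (f l \<bullet> f m) = m * (f l \<bullet> f m)"
      using f that by (simp add: scalar_mult_eq_scaleR)
    then show ?thesis using that by simp
  qed
  have inj: "inj_on f (eigenvalues A)"
    by (rule inj_onI) (metis orth f inner_eq_zero_iff)
  have "independent (f ` eigenvalues A)"
  proof (rule pairwise_orthogonal_independent)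
    show "pairwise orthogonal (f ` eigenvalues A)"
      unfolding pairwise_def orthogonal_def using orth by blast
    show "0 \<notin> f ` eigenvalues A" using f by force
  qed
  then have "finite (f ` eigenvalues A)" using independent_bound by blast
  then show ?thesis using inj finite_imageD by blast
qed

lemma chromatic_number_attained:
  fixes G :: "'n::finite \<Rightarrow> 'n \<Rightarrow> bool"
  assumes "irreflp G"
  shows "\<exists>c. proper_colouring G (chromatic_number G) c"
proof -
  obtain c :: "'n \<Rightarrow> nat" where c: "bij_betw c UNIV {0..<CARD('n)}"
    using ex_bij_betw_finite_nat[of "UNIV :: 'n set"] by auto
  have "proper_colouring G CARD('n) c"
    unfolding proper_colouring_def
    using c assms by (auto simp: bij_betw_def inj_on_def dest: irreflpD)
  then have "\<exists>k c. proper_colouring G k c" by blast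
  then show ?thesis unfolding chromatic_number_def by (rule LeastI_ex)
qed

end

(* A proper colouring of the complement splits the vertices into k cliques. Let D be the
   block-diagonal matrix with block J + t_b I on the b-th clique (J the all-ones matrix), the t_b being
   far apart: D has at most 2k distinct eigenvalues, and distinct blocks have disjoint spectra.
   Disjointness makes the Sylvester operators X |-> D_a X - X D_b invertible, so by an open mapping
   argument at the identity, every sufficiently small symmetric choice of the off-diagonal blocks is
   realised by some Q^T D Q with Q orthogonal and Q^T D Q close to D. Prescribing the pattern of G
   there leaves the entries inside the cliques nonzero and does not change the spectrum. *)
theory Submission
  imports Defs
begin

section \<open>Entrywise weights and the open mapping argument at the identity\<close>

definition hadamard :: "('n \<Rightarrow> 'm \<Rightarrow> real) \<Rightarrow> real^'m^'n \<Rightarrow> real^'m^'n" where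
  "hadamard w A = (\<chi> i j. w i j * A $ i $ j)"

lemma hadamard_nth [simp]: "hadamard w A $ i $ j = w i j * A $ i $ j"
  by (simp add: hadamard_def)

lemma bounded_linear_hadamard:
  "bounded_linear (hadamard w :: real^'m^'n \<Rightarrow> real^'m^'n)"
  by (rule linear_conv_bounded_linear[THEN iffD1], rule linearI) (simp_all add: vec_eq_iff algebra_simps)

lemma bounded_linear_transpose:
  "bounded_linear (transpose :: real^'m^'n \<Rightarrow> real^'n^'m)"
  by (rule linear_conv_bounded_linear[THEN iffD1], rule linearI)
     (simp_all add: vec_eq_iff transpose_def)

lemma bounded_bilinear_matrix_mult:
  "bounded_bilinear ((**) :: real^'m^'n \<Rightarrow> real^'k^'m \<Rightarrow> real^'k^'n)"
  unfolding bilinear_conv_bounded_bilinear[symmetric] bilinear_def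
  by (intro conjI allI linearI)
     (simp_all add: vec_eq_iff matrix_matrix_mult_def sum.distrib sum_distrib_left algebra_simps)

text \<open>Guarantees that signing the entries of a small target matrix keeps it inside the ball
  supplied by the open mapping theorem.\<close>

lemma norm_hadamard_le:
  assumes "\<And>i j. \<bar>w i j\<bar> \<le> 1"
  shows "norm (hadamard w A) \<le> norm A"
proof -
  have "norm (hadamard w A $ i) \<le> norm (A $ i)" for i
    by (rule norm_le_componentwise_cart) (simp add: abs_mult assms mult_left_le_one_le)
  then show ?thesis by (rule norm_le_componentwise_cart)
qed

text \<open>Orthogonality of \<open>Q\<close> and the prescribed blocks are packed into one equation
  in a square matrix \<open>Q\<close>. Its derivative at the identity is injective because of the
  Sylvester hypothesis, hence invertible, so all targets near the value at the identity are
  attained. The linear order on colours serves to pick one sign for each pair of blocks.\<close>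

lemma orthogonal_conjugate_off_diagonal_blocks:
  fixes D :: "real^'n^'n" and c :: "'n \<Rightarrow> 'a::linorder"
  assumes sym: "transpose D = D"
    and block: "\<And>i j. c i \<noteq> c j \<Longrightarrow> D $ i $ j = 0"
    and sylvester: "\<And>H i j. (\<And>i j. c i \<noteq> c j \<Longrightarrow> (H ** D) $ i $ j = (D ** H) $ i $ j)
      \<Longrightarrow> c i \<noteq> c j \<Longrightarrow> H $ i $ j = 0"
    and "e > 0"
  obtains d where "d > 0"
    and "\<And>B. transpose B = B \<Longrightarrow> norm B < d \<Longrightarrow>
      \<exists>Q. orthogonal_matrix Q \<and> norm (transpose Q ** D ** Q - D) < e \<and>
        (\<forall>i j. c i \<noteq> c j \<longrightarrow> (transpose Q ** D ** Q) $ i $ j = B $ i $ j)"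
proof -
  define W :: "'n \<Rightarrow> 'n \<Rightarrow> real"
    where "W i j = (if c i < c j then 1 else if c j < c i then -1 else 0)" for i j
  define V :: "'n \<Rightarrow> 'n \<Rightarrow> real" where "V i j = (if c i = c j then 1 else 0)" for i j
  have W_skew: "W i j = - W j i" for i j by (auto simp: W_def)
  have W_nz: "W i j \<noteq> 0 \<longleftrightarrow> c i \<noteq> c j" for i j by (auto simp: W_def)
  have V_sym: "V i j = V j i" for i j by (auto simp: V_def)
  define conj where "conj Q = transpose Q ** D ** Q" for Q :: "real^'n^'n"
  \<comment> \<open>Multiplying by the antisymmetric signs W turns the symmetric off-diagonal blocks into a skew
    matrix, so together with the symmetric matrix of the orthogonality equations and the skew part of
    the diagonal blocks of Q (which only removes the freedom that these leave) they form a map between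
    spaces of equal dimension.\<close>
  define \<Phi> where "\<Phi> Q = transpose Q ** Q + hadamard W (conj Q) + hadamard V (Q - transpose Q)" for Q
  define \<Phi>' where "\<Phi>' H = transpose H + H + hadamard W (transpose H ** D + D ** H)
    + hadamard V (H - transpose H)" for H
  note [continuous_intros] =
    bounded_bilinear.continuous_on[OF bounded_bilinear_matrix_mult]
    bounded_linear.continuous_on[OF bounded_linear_hadamard]
    bounded_linear.continuous_on[OF bounded_linear_transpose]
  have cont_conj: "continuous_on UNIV conj"
    unfolding conj_def by (intro continuous_intros)
  then have cont: "continuous_on UNIV \<Phi>"
    unfolding \<Phi>_def by (intro continuous_intros)
  note [derivative_intros] =
    bounded_bilinear.FDERIV[OF bounded_bilinear_matrix_mult]
    bounded_linear.has_derivative[OF bounded_linear_hadamard]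
    bounded_linear.has_derivative[OF bounded_linear_transpose]
  have deriv: "(\<Phi> has_derivative \<Phi>') (at (mat 1))"
    unfolding \<Phi>_def conj_def
    by (rule derivative_eq_intros refl)+
       (simp add: fun_eq_iff \<Phi>'_def algebra_simps)
  have lin: "linear \<Phi>'"
    using deriv has_derivative_linear by blast
  have "inj \<Phi>'"
    unfolding linear_injective_0[OF lin]
  proof (intro allI impI)
    fix H assume "\<Phi>' H = 0"
    then have eq: "H$i$j + H$j$i + W i j * ((transpose H ** D)$i$j + (D ** H)$i$j)
        + V i j * (H$i$j - H$j$i) = 0" for i j
      by (simp add: \<Phi>'_def vec_eq_iff transpose_def add.commute)
    have DH: "(transpose H ** D)$j$i = (D ** H)$i$j" for i j
    proof -
      have "transpose (transpose H ** D) = D ** H"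
        by (simp add: matrix_transpose_mul sym)
      then show ?thesis by (auto simp: vec_eq_iff transpose_def)
    qed
    \<comment> \<open>By \<open>DH\<close> the factor next to \<open>W\<close> is symmetric, so the
      \<open>W\<close> and \<open>V\<close> terms are both antisymmetric. They cancel when the
      equations at (i,j) and (j,i) are added.\<close>
    have skew: "H$i$j = - H$j$i" for i j
      using eq[of i j] eq[of j i] W_skew[of i j] V_sym[of i j]
      by (simp add: DH algebra_simps)
    have "transpose H = - H"
      by (simp only: vec_eq_iff transpose_def vec_lambda_beta vector_uminus_component)
         (blast intro: skew)
    then have "transpose H ** D = (- H) ** D"
      by (rule arg_cong[where f = "\<lambda>M. M ** D"])
    also have "\<dots> = - (H ** D)"
      by (rule bounded_bilinear.minus_left[OF bounded_bilinear_matrix_mult])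
    finally have tHD: "(transpose H ** D)$i$j = - (H ** D)$i$j" for i j
      by (simp only: vector_uminus_component)
    \<comment> \<open>For skew \<open>H\<close> the \<open>W\<close> term is the commutator of
      \<open>D\<close> and \<open>H\<close>, and outside the diagonal blocks nothing else remains of
      the equation.\<close>
    have "(H ** D)$i$j = (D ** H)$i$j" if "c i \<noteq> c j" for i j
    proof -
      have "W i j * ((D ** H)$i$j - (H ** D)$i$j) = 0"
        using eq[of i j] unfolding tHD skew[of i j] using that by (simp add: V_def)
      then show ?thesis using that W_nz[of i j] by simp
    qed
    then have off: "H$i$j = 0" if "c i \<noteq> c j" for i j
      using sylvester that by blast
    \<comment> \<open>Inside a diagonal block the \<open>V\<close> term makes \<open>H\<close>
      symmetric there as well as skew.\<close>
    have "H$i$j = 0" for i j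
      using eq[of i j] skew[of i j] off[of i j] by (cases "c i = c j") (auto simp: W_def V_def)
    then show "H = 0" by (simp add: vec_eq_iff)
  qed
  then obtain g where g: "linear g" "\<Phi>' \<circ> g = id"
    using linear_injective_isomorphism[OF lin] by (auto simp: fun_eq_iff)
  \<comment> \<open>Applying the open mapping theorem to \<open>T\<close> instead of the whole space
    makes the solution \<open>Q\<close> satisfy the closeness bound automatically.\<close>
  define T where "T = {Q. norm (conj Q - D) < e}"
  have "open T"
    unfolding T_def by (intro open_Collect_less continuous_intros cont_conj)
  moreover have "mat 1 \<in> T"
    using \<open>e > 0\<close> by (simp add: T_def conj_def)
  ultimately have "mat 1 \<in> interior T"
    by (simp add: interior_open)
  then have "\<Phi> (mat 1) \<in> interior (\<Phi> ` T)"
    using sussmann_open_mapping[OF open_UNIV cont UNIV_I deriv _ g(2)] g(1)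
    by (simp add: linear_conv_bounded_linear)
  then obtain d where d: "d > 0" "ball (\<Phi> (mat 1)) d \<subseteq> \<Phi> ` T"
    unfolding mem_interior by blast
  \<comment> \<open>The \<open>W\<close> term vanishes at the identity: \<open>W\<close> is zero
    inside the diagonal blocks and \<open>D\<close> is zero outside them.\<close>
  have \<Phi>1: "\<Phi> (mat 1) = mat 1"
    using block W_nz by (auto simp: \<Phi>_def conj_def vec_eq_iff)
  show thesis
  proof
    show "d > 0" by fact
    fix B :: "real^'n^'n" assume B: "transpose B = B" "norm B < d"
    have "norm (hadamard W B) < d"
      using norm_hadamard_le[of W B] B(2) by (force simp: W_def)
    then have "mat 1 + hadamard W B \<in> ball (\<Phi> (mat 1)) d"
      by (simp add: \<Phi>1 dist_norm)
    then obtain Q where Q: "Q \<in> T" "\<Phi> Q = mat 1 + hadamard W B"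
      using d(2) by force
    define P where "P = transpose Q ** Q"
    have P_sym: "P$i$j = P$j$i" for i j
    proof -
      have "transpose P = P" by (simp add: P_def matrix_transpose_mul)
      then show ?thesis by (auto simp: vec_eq_iff transpose_def)
    qed
    have A_sym: "conj Q$i$j = conj Q$j$i" for i j
    proof -
      have "transpose (conj Q) = conj Q"
        by (simp add: conj_def matrix_transpose_mul sym matrix_mul_assoc)
      then show ?thesis by (auto simp: vec_eq_iff transpose_def)
    qed
    have B_sym: "B$i$j = B$j$i" for i j
      using B(1) by (auto simp: vec_eq_iff transpose_def)
    have eq: "P$i$j + W i j * conj Q$i$j + V i j * (Q$i$j - Q$j$i)
        = (mat 1 :: real^'n^'n)$i$j + W i j * B$i$j" for i j
      using arg_cong[OF Q(2), of "\<lambda>M. M$i$j"]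
      by (simp add: \<Phi>_def P_def transpose_def)
    \<comment> \<open>The symmetric part of the equation gives orthogonality, the skew part the blocks.\<close>
    have P: "P$i$j = (mat 1 :: real^'n^'n)$i$j" for i j
      using eq[of i j] eq[of j i] W_skew[of i j] V_sym[of i j] P_sym[of i j] A_sym[of i j] B_sym[of i j]
      by (simp add: mat_def algebra_simps split: if_splits)
    then have "orthogonal_matrix Q"
      by (simp add: orthogonal_matrix P_def vec_eq_iff)
    moreover have "conj Q$i$j = B$i$j" if "c i \<noteq> c j" for i j
      using eq[of i j] P[of i j] W_nz[of i j] that by (simp add: V_def)
    ultimately show "\<exists>Q. orthogonal_matrix Q \<and> norm (transpose Q ** D ** Q - D) < e \<and>
        (\<forall>i j. c i \<noteq> c j \<longrightarrow> (transpose Q ** D ** Q) $ i $ j = B $ i $ j)"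
      using Q(1) by (auto simp: T_def conj_def)
  qed
qed

section \<open>Spectrum under orthogonal conjugation\<close>

lemma eigenvalues_orthogonal_conjugate_subset:
  assumes "orthogonal_matrix Q"
  shows "eigenvalues (transpose Q ** D ** Q) \<subseteq> eigenvalues D"
proof
  fix l assume "l \<in> eigenvalues (transpose Q ** D ** Q)"
  then obtain v where v: "v \<noteq> 0" "(transpose Q ** D ** Q) *v v = l *s v"
    by (auto simp: eigenvalues_def)
  have QQ: "Q ** transpose Q = mat 1" "transpose Q ** Q = mat 1"
    using assms by (auto simp: orthogonal_matrix_def)
  have "Q *v v \<noteq> 0"
    using v(1) QQ(2) by (metis matrix_vector_mul_assoc matrix_vector_mul_lid matrix_vector_mult_0_right)
  moreover have "D *v (Q *v v) = Q *v ((transpose Q ** D ** Q) *v v)"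
    using QQ(1) by (metis matrix_mul_assoc matrix_mul_lid matrix_vector_mul_assoc)
  then have "D *v (Q *v v) = l *s (Q *v v)"
    by (simp add: v(2) vector_scalar_commute)
  ultimately show "l \<in> eigenvalues D"
    by (auto simp: eigenvalues_def)
qed

section \<open>Clique matrices: spectrum and the Sylvester condition\<close>

definition clique_matrix :: "('n \<Rightarrow> 'b) \<Rightarrow> ('b \<Rightarrow> real) \<Rightarrow> real^'n^'n" where
  "clique_matrix c t = (\<chi> i j. (if c i = c j then 1 else 0) + (if i = j then t (c i) else 0))"

lemma transpose_clique_matrix: "transpose (clique_matrix c t) = clique_matrix c t"
  by (simp add: clique_matrix_def transpose_def vec_eq_iff)

lemma clique_matrix_vector_mult_nth:
  fixes c :: "'n::finite \<Rightarrow> 'b"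
  shows "(clique_matrix c t *v v) $ i = (\<Sum>k | c k = c i. v $ k) + t (c i) * v $ i"
proof -
  have "(clique_matrix c t *v v) $ i =
      (\<Sum>k\<in>UNIV. (if c k = c i then v $ k else 0) + (if k = i then t (c i) * v $ i else 0))"
    unfolding matrix_vector_mult_def clique_matrix_def vec_lambda_beta
    by (rule sum.cong) (auto simp: distrib_right)
  then show ?thesis
    by (simp add: sum.distrib sum.If_cases)
qed

lemma clique_matrix_mult_nth:
  fixes c :: "'n::finite \<Rightarrow> 'b"
  shows "(clique_matrix c t ** H) $ i $ j = (\<Sum>k | c k = c i. H $ k $ j) + t (c i) * H $ i $ j"
proof -
  have "(clique_matrix c t ** H) $ i $ j = (clique_matrix c t *v column j H) $ i"
    by (simp add: matrix_matrix_mult_def matrix_vector_mult_def column_def)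
  then show ?thesis
    by (simp add: clique_matrix_vector_mult_nth column_def)
qed

lemma mult_clique_matrix_nth:
  fixes c :: "'n::finite \<Rightarrow> 'b"
  shows "(H ** clique_matrix c t) $ i $ j = (\<Sum>k | c k = c j. H $ i $ k) + t (c j) * H $ i $ j"
proof -
  have "transpose (H ** clique_matrix c t) = clique_matrix c t ** transpose H"
    by (simp add: matrix_transpose_mul transpose_clique_matrix)
  then have "(H ** clique_matrix c t) $ i $ j = (clique_matrix c t ** transpose H) $ j $ i"
    by (auto simp: vec_eq_iff transpose_def[of "H ** _"])
  then show ?thesis
    by (simp add: clique_matrix_mult_nth transpose_def)
qed

text \<open>Take a class on which the eigenvector is nonzero and sum the eigenvalue equation over
  it. If the sum \<open>S b\<close> of the entries is nonzero, it can be cancelled and leaves the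
  larger value; if it is zero, the all-ones part contributes nothing and \<open>t b\<close>
  remains.\<close>

lemma eigenvalues_clique_matrix_subset:
  fixes c :: "'n::finite \<Rightarrow> 'b"
  shows "eigenvalues (clique_matrix c t) \<subseteq>
    (\<Union>b\<in>range c. {t b, t b + real (card {k. c k = b})})"
proof
  fix l assume "l \<in> eigenvalues (clique_matrix c t)"
  then obtain v where v: "v \<noteq> 0" "clique_matrix c t *v v = l *s v"
    by (auto simp: eigenvalues_def)
  define S where "S b = (\<Sum>k | c k = b. v $ k)" for b
  have eq: "S (c i) + t (c i) * v $ i = l * v $ i" for i
    using clique_matrix_vector_mult_nth[of c t v i] v(2) by (simp add: S_def)
  obtain i where i: "v $ i \<noteq> 0"
    using v(1) by (auto simp: vec_eq_iff)
  define b where "b = c i"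
  have "(\<Sum>k | c k = b. S b + t b * v $ k) = (\<Sum>k | c k = b. l * v $ k)"
    by (rule sum.cong) (use eq in auto)
  then have "real (card {k. c k = b}) * S b + t b * S b = l * S b"
    by (simp add: sum.distrib S_def sum_distrib_left)
  then have "(t b + real (card {k. c k = b}) - l) * S b = 0"
    by (simp add: algebra_simps)
  then have "l = t b + real (card {k. c k = b}) \<or> S b = 0"
    by auto
  then have "l = t b + real (card {k. c k = b}) \<or> l = t b"
    using eq[of i] i by (auto simp: b_def)
  then show "l \<in> (\<Union>b\<in>range c. {t b, t b + real (card {k. c k = b})})"
    by (auto simp: b_def)
qed

lemma card_eigenvalues_clique_matrix_le:
  fixes c :: "'n::finite \<Rightarrow> 'b"
  shows "card (eigenvalues (clique_matrix c t)) \<le> 2 * card (range c)"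
proof -
  let ?F = "\<lambda>b. {t b, t b + real (card {k. c k = b})}"
  have "card (eigenvalues (clique_matrix c t)) \<le> card (\<Union>b\<in>range c. ?F b)"
    by (rule card_mono[OF _ eigenvalues_clique_matrix_subset]) simp
  also have "\<dots> \<le> (\<Sum>b\<in>range c. card (?F b))"
    by (rule card_UN_le) simp
  also have "\<dots> \<le> (\<Sum>b\<in>range c. 2)"
    by (rule sum_mono) (simp add: card_insert_if)
  finally show ?thesis by simp
qed

text \<open>A diagonal dominance argument: each of the two all-ones parts contributes at most
  \<open>CARD('n)\<close> times the maximal modulus, which the gap between the shifts
  \<open>t\<close> outweighs unless that maximum is zero.\<close>

lemma clique_matrix_sylvester:
  fixes c :: "'n::finite \<Rightarrow> 'b" and H :: "real^'n^'n"
  assumes gap: "\<And>a b. a \<noteq> b \<Longrightarrow> \<bar>t a - t b\<bar> > 2 * real CARD('n)"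
    and comm: "\<And>i j. c i \<noteq> c j \<Longrightarrow>
      (H ** clique_matrix c t) $ i $ j = (clique_matrix c t ** H) $ i $ j"
    and "c i \<noteq> c j"
  shows "H $ i $ j = 0"
proof -
  \<comment> \<open>Evaluate the equation at an entry of maximal modulus outside the diagonal blocks.\<close>
  define X where "X = {(p, q). c p \<noteq> c q}"
  define M where "M = Max ((\<lambda>(p, q). \<bar>H $ p $ q\<bar>) ` X)"
  have le: "\<bar>H $ p $ q\<bar> \<le> M" if "c p \<noteq> c q" for p q
    unfolding M_def by (rule Max_ge) (use that in \<open>force simp: X_def\<close>)+
  have "M \<in> (\<lambda>(p, q). \<bar>H $ p $ q\<bar>) ` X"
    unfolding M_def by (rule Max_in) (use assms(3) in \<open>auto simp: X_def\<close>)
  then obtain p q where pq: "c p \<noteq> c q" "M = \<bar>H $ p $ q\<bar>"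
    by (auto simp: X_def)
  then have "M \<ge> 0" by simp
  have bound: "\<bar>\<Sum>k\<in>K. f k\<bar> \<le> real CARD('n) * M"
    if "\<And>k. k \<in> K \<Longrightarrow> \<bar>f k\<bar> \<le> M" for K :: "'n set" and f :: "'n \<Rightarrow> real"
  proof -
    have "\<bar>\<Sum>k\<in>K. f k\<bar> \<le> (\<Sum>k\<in>K. \<bar>f k\<bar>)" by (rule sum_abs)
    also have "\<dots> \<le> real (card K) * M" using sum_bounded_above[of K "\<lambda>k. \<bar>f k\<bar>" M] that by simp
    also have "\<dots> \<le> real CARD('n) * M"
      using \<open>M \<ge> 0\<close> by (intro mult_right_mono) (simp_all add: card_mono)
    finally show ?thesis .
  qed
  have "(t (c p) - t (c q)) * H $ p $ q = (\<Sum>k | c k = c q. H $ p $ k) - (\<Sum>k | c k = c p. H $ k $ q)"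
    using comm[OF pq(1)]
    by (simp add: clique_matrix_mult_nth mult_clique_matrix_nth algebra_simps)
  then have "\<bar>t (c p) - t (c q)\<bar> * M \<le> \<bar>\<Sum>k | c k = c q. H $ p $ k\<bar> + \<bar>\<Sum>k | c k = c p. H $ k $ q\<bar>"
    by (metis abs_mult abs_triangle_ineq4 pq(2))
  also have "\<dots> \<le> 2 * real CARD('n) * M"
    using bound[of "{k. c k = c q}" "\<lambda>k. H $ p $ k"] bound[of "{k. c k = c p}" "\<lambda>k. H $ k $ q"] pq(1)
    by (auto simp: le)
  finally have "M \<le> 0"
    using gap[OF pq(1)] by (metis mult_less_cancel_right not_le)
  then show ?thesis using le[OF assms(3)] by simp
qed

section \<open>Realising the pattern of \<open>G\<close> with the spectrum of a clique
  matrix\<close>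

theorem theorem3p9:
  fixes G :: "'n::finite \<Rightarrow> 'n \<Rightarrow> bool"
  assumes "simple_graph G"
  shows "q_graph G \<le> 2 * chromatic_number (complement_graph G)"
proof -
  have "irreflp (complement_graph G)"
    by (simp add: complement_graph_def irreflp_def)
  then obtain c where c: "proper_colouring (complement_graph G) (chromatic_number (complement_graph G)) c"
    using chromatic_number_attained by blast
  then have clique: "G i j" if "c i = c j" "i \<noteq> j" for i j
    using that by (auto simp: proper_colouring_def complement_graph_def)
  have "range c \<subseteq> {..<chromatic_number (complement_graph G)}"
    using c by (auto simp: proper_colouring_def)
  from card_mono[OF finite_lessThan this]
  have card_c: "card (range c) \<le> chromatic_number (complement_graph G)"
    by simp
  have G_sym: "G i j \<longleftrightarrow> G j i" for i j
    using assms unfolding simple_graph_def by (blast dest: sympD)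
  \<comment> \<open>Distinct colours differ by at least 1, so the factor 3 gives a gap strictly
    above the required \<open>2 * real CARD('n)\<close>.\<close>
  define t where "t b = 3 * real CARD('n) * real b" for b
  have gap: "\<bar>t a - t b\<bar> > 2 * real CARD('n)" if "a \<noteq> b" for a b
  proof -
    have "\<bar>t a - t b\<bar> = 3 * real CARD('n) * \<bar>real a - real b\<bar>"
      by (simp add: t_def abs_mult flip: right_diff_distrib)
    also have "\<dots> \<ge> 3 * real CARD('n) * 1"
      by (rule mult_left_mono) (use that in auto)
    finally show ?thesis by (smt (verit) of_nat_0_less_iff zero_less_card_finite)
  qed
  define D where "D = clique_matrix c t"
  \<comment> \<open>The tolerance 1 matches the off-diagonal entries of \<open>D\<close> inside a
    clique: they equal 1, so a change of modulus below 1 keeps them nonzero.\<close>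
  obtain d where d: "d > 0" and conj: "\<And>B. transpose B = B \<Longrightarrow> norm B < d \<Longrightarrow>
      \<exists>Q. orthogonal_matrix Q \<and> norm (transpose Q ** D ** Q - D) < 1 \<and>
        (\<forall>i j. c i \<noteq> c j \<longrightarrow> (transpose Q ** D ** Q) $ i $ j = B $ i $ j)"
  proof (rule orthogonal_conjugate_off_diagonal_blocks[of D c 1])
    show "transpose D = D" by (simp add: D_def transpose_clique_matrix)
    show "D $ i $ j = 0" if "c i \<noteq> c j" for i j
      using that by (auto simp: D_def clique_matrix_def)
    show "H $ i $ j = 0"
      if "\<And>i j. c i \<noteq> c j \<Longrightarrow> (H ** D) $ i $ j = (D ** H) $ i $ j" "c i \<noteq> c j" for H i j
      by (rule clique_matrix_sylvester[OF gap that[unfolded D_def]])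
  qed (use that in \<open>simp_all\<close>)
  define B\<^sub>1 :: "real^'n^'n" where "B\<^sub>1 = (\<chi> i j. if G i j then 1 else 0)"
  \<comment> \<open>The added 1 keeps the denominator positive for edgeless \<open>G\<close> and
    makes the norm bound below strict.\<close>
  define s where "s = d / (norm B\<^sub>1 + 1)"
  have "s > 0" using d by (simp add: s_def add_nonneg_pos)
  have "norm (s *\<^sub>R B\<^sub>1) < d"
    using d by (simp add: s_def divide_less_eq mult_strict_left_mono add_nonneg_pos)
  moreover have "transpose (s *\<^sub>R B\<^sub>1) = s *\<^sub>R B\<^sub>1"
    using G_sym by (simp add: B\<^sub>1_def transpose_def vec_eq_iff)
  ultimately obtain Q where Q: "orthogonal_matrix Q" "norm (transpose Q ** D ** Q - D) < 1"
    "\<And>i j. c i \<noteq> c j \<Longrightarrow> (transpose Q ** D ** Q) $ i $ j = (s *\<^sub>R B\<^sub>1) $ i $ j"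
    using conj by blast
  define A where "A = transpose Q ** D ** Q"
  have "transpose A = A"
    by (simp add: A_def D_def matrix_transpose_mul transpose_clique_matrix matrix_mul_assoc)
  moreover have "A $ i $ j \<noteq> 0 \<longleftrightarrow> G i j" if "i \<noteq> j" for i j
  proof (cases "c i = c j")
    case True
    have "\<bar>(A - D) $ i $ j\<bar> \<le> norm (A - D)"
      by (rule order_trans[OF component_le_norm_cart Finite_Cartesian_Product.norm_nth_le])
    then have "\<bar>(A - D) $ i $ j\<bar> < 1"
      using Q(2) by (simp add: A_def)
    moreover have "D $ i $ j = 1"
      using True that by (simp add: D_def clique_matrix_def)
    ultimately have "A $ i $ j \<noteq> 0" by auto
    then show ?thesis using clique True that by simp
  next
    case False
    then show ?thesis using Q(3)[of i j] \<open>s > 0\<close> by (simp add: A_def B\<^sub>1_def)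
  qed
  ultimately have "A \<in> sym_matrices G"
    by (simp add: sym_matrices_def)
  then have "q_graph G \<le> card (eigenvalues A)"
    using q_graph_le by (force simp: q_matrix_def)
  also have "\<dots> \<le> card (eigenvalues D)"
    unfolding A_def D_def
    by (intro card_mono finite_eigenvalues transpose_clique_matrix
        eigenvalues_orthogonal_conjugate_subset Q(1))
  also have "\<dots> \<le> 2 * card (range c)"
    unfolding D_def by (rule card_eigenvalues_clique_matrix_le)
  finally show ?thesis using card_c by simp
qed

end
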